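(* For $n$ a power of $2$, $$S_{(2\log n)\text{-SR-I}}(\mathrm{bPHP}_n)=\mathcal{O}(n^2).$$
   Context: $\log$ is the binary logarithm. For $n$ a power of $2$, $\mathrm{bPHP}_n$ is the CNF in the variables $x_{i,j}$ ($1\le i\le n+1$, $1\le j\le \log n$) $$\bigwedge_{1\le i<j\le n+1,\ 0\le y<n}(\overline{x_{i,1}\ldots x_{i,\log n}}\ne y)\lor(\overline{x_{j,1}\ldots x_{j,\log n}}\ne y),$$ where $\overline{x_1\ldots x_m}$ is the integer with binary representation $x_1\ldots x_m$; each non-equality $(\overline{x_{i,1}\ldots x_{i,\log n}}\neq y)$ is written as the disjunction of $\log n$ literals expressing it. A clause is a disjunction (set) of literals. For $k\ge1$ (a constant or a function), a $k$-symmetry is a bijection $\phi$ of literals onto literals with $\phi(\lnot x)=\lnot\phi(x)$ and $\phi(x)=x$ for all variables $x$ except at most $k$ of them; it acts on clauses literal by literal. It is positive if it maps variables to variables (without negation). A $k$-SR-I proof (Resolution with global positive $k$-symmetries) of an unsatisfiable CNF $\Phi$ is a sequence of clauses ending with the empty clause, each of which is an input clause, or is obtained from earlier clauses by the resolution rule (from $A\lor x$ and $B\lor\lnot x$ infer $A\lor B$), or is obtained by the symmetry rule: if a clause $A$ was inferred earlier in the proof from $B_1,\dots,B_l$, and $\phi$ is a positive $k$-symmetry such that both sets $\{B_i\}$ and $\{\phi(B_i)\}$ are equal to the set of all input clauses, infer $\phi(A)$ in one step. There is no weakening rule. $S_\Pi(\Phi)$ is the number of steps in the shortest proof of $\Phi$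 in the proof system $\Pi$. *)

theory Defs
  imports
    Complex_Main
    "HOL-Library.Landau_Symbols"
    "HOL-Library.Extended_Nat"
    "HOL-Library.Discrete_Functions"
begin

datatype 'v lit = Pos 'v | Neg 'v

fun negl :: "'v lit \<Rightarrow> 'v lit" where
  "negl (Pos x) = Neg x"
| "negl (Neg x) = Pos x"

fun lit_true :: "('v \<Rightarrow> bool) \<Rightarrow> 'v lit \<Rightarrow> bool" where
  "lit_true \<alpha> (Pos x) = \<alpha> x"
| "lit_true \<alpha> (Neg x) = (\<not> \<alpha> x)"

type_synonym 'v clause = "'v lit set"
type_synonym 'v cnf = "'v clause set"

definition resolvent :: "'v clause \<Rightarrow> 'v clause \<Rightarrow> 'v clause \<Rightarrow> bool" where
  "resolvent C D R \<longleftrightarrow>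
     (\<exists>A B x. C = insert (Pos x) A \<and> Pos x \<notin> A \<and> D = insert (Neg x) B \<and> Neg x \<notin> B \<and> R = A \<union> B)"

definition k_symmetry :: "nat \<Rightarrow> ('v lit \<Rightarrow> 'v lit) \<Rightarrow> bool" where
  "k_symmetry k \<phi> \<longleftrightarrow> bij \<phi> \<and> (\<forall>l. \<phi> (negl l) = negl (\<phi> l)) \<and>
     finite {x. \<phi> (Pos x) \<noteq> Pos x} \<and> card {x. \<phi> (Pos x) \<noteq> Pos x} \<le> k"

definition positive :: "('v lit \<Rightarrow> 'v lit) \<Rightarrow> bool" where
  "positive \<phi> \<longleftrightarrow> (\<forall>x. \<exists>y. \<phi> (Pos x) = Pos y)"

(* Every clause of a derivation is inferred from the hypothesis set F of all input clauses, so a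
   global symmetry is one whose action on clauses maps F onto itself. *)
definition SR_I_proof :: "nat \<Rightarrow> 'v cnf \<Rightarrow> 'v clause list \<Rightarrow> bool" where
  "SR_I_proof k F \<pi> \<longleftrightarrow> \<pi> \<noteq> [] \<and> last \<pi> = {} \<and>
     (\<forall>i < length \<pi>.
        \<pi> ! i \<in> F \<or>
        (\<exists>a < i. \<exists>b < i. resolvent (\<pi> ! a) (\<pi> ! b) (\<pi> ! i)) \<or>
        (\<exists>a < i. \<exists>\<phi>. k_symmetry k \<phi> \<and> positive \<phi> \<and> (\<lambda>C. \<phi> ` C) ` F = F \<and> \<pi> ! i = \<phi> ` (\<pi> ! a)))"

(* All lines of a proof are counted, also those that quote an input clause.  The value is \<infinity> if
   there is no proof. *)
definition S_SR_I :: "nat \<Rightarrow> 'v cnf \<Rightarrow> enat" where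
  "S_SR_I k F = (INF \<pi> \<in> {\<pi>. SR_I_proof k F \<pi>}. enat (length \<pi>))"

(* The variable x_{i,j} is the pair (i, j); x_{i,1} is the most significant of the m bits. *)
definition neq_clause :: "nat \<Rightarrow> nat \<Rightarrow> nat \<Rightarrow> (nat \<times> nat) clause" where
  "neq_clause m i y = (\<lambda>j. if bit y (m - j) then Neg (i, j) else Pos (i, j)) ` {1..m}"

definition bPHP :: "nat \<Rightarrow> (nat \<times> nat) cnf" where
  "bPHP n = {neq_clause (floor_log n) i y \<union> neq_clause (floor_log n) j y | i j y.
               1 \<le> i \<and> i < j \<and> j \<le> n + 1 \<and> y < n}"

lemma neq_clause_correct:
  assumes "y < 2 ^ m"
  shows "(\<exists>l \<in> neq_clause m i y. lit_true \<alpha> l) \<longleftrightarrow>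
           (\<Sum>j = 1..m. of_bool (\<alpha> (i, j)) * 2 ^ (m - j)) \<noteq> y"
proof -
  define b where "b k = \<alpha> (i, m - k)" for k
  define v :: nat where "v = horner_sum of_bool 2 (map b [0..<m])"
  have "(\<Sum>j = 1..m. of_bool (\<alpha> (i, j)) * 2 ^ (m - j)) = (\<Sum>k = 0..<m. of_bool (b k) * (2::nat) ^ k)"
    by (rule sum.reindex_bij_witness[of _ "\<lambda>k. m - k" "\<lambda>j. m - j"]) (auto simp: b_def)
  also have "\<dots> = v"
    by (simp add: v_def horner_sum_eq_sum)
  finally have v: "(\<Sum>j = 1..m. of_bool (\<alpha> (i, j)) * 2 ^ (m - j)) = v" .
  have vbit: "bit v k \<longleftrightarrow> k < m \<and> b k" for k
    by (auto simp: v_def bit_horner_sum_bit_iff)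
  have ybit: "bit y k \<Longrightarrow> k < m" for k
    using assms by (metis bit_take_bit_iff take_bit_nat_eq_self)
  have "v = y \<longleftrightarrow> (\<forall>k < m. b k = bit y k)"
    using vbit ybit by (auto simp: bit_eq_iff)
  also have "\<dots> \<longleftrightarrow> (\<forall>j \<in> {1..m}. \<alpha> (i, j) = bit y (m - j))"
  proof safe
    fix j assume "\<forall>k < m. b k = bit y k" "j \<in> {1..m}"
    then show "\<alpha> (i, j)" if "bit y (m - j)" using that by (auto simp: b_def dest!: spec[of _ "m - j"])
  next
    fix j assume "\<forall>k < m. b k = bit y k" "j \<in> {1..m}"
    then show "bit y (m - j)" if "\<alpha> (i, j)" using that by (auto simp: b_def dest!: spec[of _ "m - j"])
  next
    fix k assume "\<forall>j \<in> {1..m}. \<alpha> (i, j) = bit y (m - j)" "k < m"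
    then show "bit y k" if "b k" using that by (auto simp: b_def dest!: bspec[of _ _ "m - k"])
  next
    fix k assume "\<forall>j \<in> {1..m}. \<alpha> (i, j) = bit y (m - j)" "k < m"
    then show "b k" if "bit y k" using that by (auto simp: b_def dest!: bspec[of _ _ "m - k"])
  qed
  finally have eq: "v = y \<longleftrightarrow> (\<forall>j \<in> {1..m}. \<alpha> (i, j) = bit y (m - j))" .
  have "(\<exists>l \<in> neq_clause m i y. lit_true \<alpha> l) \<longleftrightarrow> (\<exists>j \<in> {1..m}. \<alpha> (i, j) \<noteq> bit y (m - j))"
    unfolding neq_clause_def bex_simps(7) by (rule bex_cong) auto
  then show ?thesis
    unfolding v eq by blast
qed

end

theory Submission
  imports Defs "HOL-Combinatorics.Transposition"
begin

text \<open>
  Consider the clause saying that \<open>2\<^sup>h + 1\<close> pigeons cannot all sit in holes whose binary representations share a prefix that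
  leaves \<open>h\<close> bits free; for \<open>h = 0\<close> this is an input clause, and when no bit is fixed it is the
  empty clause. With \<open>a = 2\<^sup>h\<close>, the statement for a prefix \<open>q\<close> and \<open>2 a + 1\<close> pigeons follows from those
  for \<open>q0\<close> and \<open>q1\<close>: resolving on the next bit of one pigeon after another, only the numbers of
  pigeons already sent to \<open>q0\<close> and to \<open>q1\<close> matter, as a transposition of two pigeons restores a
  normal form. So a prefix costs \<open>O(a\<^sup>2)\<close> steps, and the sum over the binary tree of prefixes is
  dominated by the root. Weakening is avoided by tracking clauses up to subsumption.
\<close>

section \<open>Derivations up to subsumption\<close>

definition inferable :: "nat \<Rightarrow> 'v cnf \<Rightarrow> 'v cnf \<Rightarrow> 'v clause \<Rightarrow> bool" where
  "inferable k F S C \<longleftrightarrow> C \<in> F \<or> (\<exists>A \<in> S. \<exists>B \<in> S. resolvent A B C) \<or>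
     (\<exists>A \<in> S. \<exists>\<phi>. k_symmetry k \<phi> \<and> positive \<phi> \<and> (\<lambda>C. \<phi> ` C) ` F = F \<and> C = \<phi> ` A)"

definition derivation :: "nat \<Rightarrow> 'v cnf \<Rightarrow> 'v clause list \<Rightarrow> bool" where
  "derivation k F \<pi> \<longleftrightarrow> (\<forall>i < length \<pi>. inferable k F (set (take i \<pi>)) (\<pi> ! i))"

lemma derivation_snoc:
  assumes "derivation k F \<pi>" "inferable k F (set \<pi>) C"
  shows "derivation k F (\<pi> @ [C])"
  using assms by (auto simp: derivation_def nth_append less_Suc_eq)

lemma derivation_take:
  assumes "derivation k F \<pi>"
  shows "derivation k F (take i \<pi>)"
  using assms by (auto simp: derivation_def min_def)

lemma SR_I_proof_if_derivation:
  assumes "derivation k F \<pi>" "\<pi> \<noteq> []" "last \<pi> = {}"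
  shows "SR_I_proof k F \<pi>"
  unfolding SR_I_proof_def
proof (intro conjI allI impI)
  fix i assume i: "i < length \<pi>"
  have take: "set (take i \<pi>) = (!) \<pi> ` {..<i}"
    using i nth_image[of i \<pi>] by (simp add: atLeast0LessThan)
  have "inferable k F (set (take i \<pi>)) (\<pi> ! i)"
    using assms(1) i by (simp add: derivation_def)
  then show "\<pi> ! i \<in> F \<or> (\<exists>a < i. \<exists>b < i. resolvent (\<pi> ! a) (\<pi> ! b) (\<pi> ! i)) \<or>
      (\<exists>a < i. \<exists>\<phi>. k_symmetry k \<phi> \<and> positive \<phi> \<and> (\<lambda>C. \<phi> ` C) ` F = F \<and> \<pi> ! i = \<phi> ` (\<pi> ! a))"
    unfolding inferable_def take bex_simps(7) by (simp only: Bex_def lessThan_iff)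
qed (use assms in auto)

definition subsumed :: "'v cnf \<Rightarrow> 'v clause \<Rightarrow> bool" where
  "subsumed S C \<longleftrightarrow> (\<exists>D \<in> S. D \<subseteq> C)"

text \<open>A relative cost. Quantifying over every derivation \<open>\<pi>\<close>, and keeping all
  its clauses in \<open>\<rho>\<close>, lets costs add up under composition while a clause shared by
  several later steps is paid for once.\<close>

definition yields :: "nat \<Rightarrow> 'v cnf \<Rightarrow> nat \<Rightarrow> 'v cnf \<Rightarrow> 'v cnf \<Rightarrow> bool" where
  "yields k F c \<A> \<B> \<longleftrightarrow>
     (\<forall>\<pi>. derivation k F \<pi> \<and> (\<forall>A \<in> \<A>. subsumed (set \<pi>) A) \<longrightarrow>
        (\<exists>\<rho>. derivation k F \<rho> \<and> set \<pi> \<subseteq> set \<rho> \<and> length \<rho> \<le> length \<pi> + c \<and>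
             (\<forall>B \<in> \<B>. subsumed (set \<rho>) B)))"

lemma subsumed_mono: "subsumed S C \<Longrightarrow> S \<subseteq> T \<Longrightarrow> C \<subseteq> D \<Longrightarrow> subsumed T D"
  unfolding subsumed_def by blast

lemma yields_mono:
  assumes "yields k F c \<A> \<B>" "\<A> \<subseteq> \<A>'" "\<B>' \<subseteq> \<B>" "c \<le> c'"
  shows "yields k F c' \<A>' \<B>'"
  unfolding yields_def
proof (intro allI impI)
  fix \<pi> assume "derivation k F \<pi> \<and> (\<forall>A \<in> \<A>'. subsumed (set \<pi>) A)"
  then obtain \<rho> where "derivation k F \<rho>" "set \<pi> \<subseteq> set \<rho>" "length \<rho> \<le> length \<pi> + c"
      "\<forall>B \<in> \<B>. subsumed (set \<rho>) B"
    using assms(1,2) unfolding yields_def by (meson subsetD)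
  then show "\<exists>\<rho>. derivation k F \<rho> \<and> set \<pi> \<subseteq> set \<rho> \<and> length \<rho> \<le> length \<pi> + c' \<and>
      (\<forall>B \<in> \<B>'. subsumed (set \<rho>) B)"
    using assms(3,4) by (intro exI[of _ \<rho>]) auto
qed

lemma yields_trans:
  assumes "yields k F c \<A> \<B>" "yields k F d (\<A> \<union> \<B>) \<C>"
  shows "yields k F (c + d) \<A> (\<B> \<union> \<C>)"
  unfolding yields_def
proof (intro allI impI)
  fix \<pi> assume \<pi>: "derivation k F \<pi> \<and> (\<forall>A \<in> \<A>. subsumed (set \<pi>) A)"
  then obtain \<rho> where \<rho>: "derivation k F \<rho>" "set \<pi> \<subseteq> set \<rho>" "length \<rho> \<le> length \<pi> + c"
      "\<forall>B \<in> \<B>. subsumed (set \<rho>) B"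
    using assms(1) unfolding yields_def by meson
  then have "\<forall>A \<in> \<A> \<union> \<B>. subsumed (set \<rho>) A"
    using \<pi> subsumed_mono by blast
  then obtain \<sigma> where \<sigma>: "derivation k F \<sigma>" "set \<rho> \<subseteq> set \<sigma>" "length \<sigma> \<le> length \<rho> + d"
      "\<forall>C \<in> \<C>. subsumed (set \<sigma>) C"
    using assms(2) \<rho>(1) unfolding yields_def by meson
  moreover have "\<forall>B \<in> \<B> \<union> \<C>. subsumed (set \<sigma>) B"
    using \<rho>(4) \<sigma>(2,4) subsumed_mono by blast
  ultimately show "\<exists>\<rho>. derivation k F \<rho> \<and> set \<pi> \<subseteq> set \<rho> \<and> length \<rho> \<le> length \<pi> + (c + d) \<and>
      (\<forall>B \<in> \<B> \<union> \<C>. subsumed (set \<rho>) B)"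
    using \<rho>(2,3) by (intro exI[of _ \<sigma>]) auto
qed

text \<open>Subsumption is transitive, so \<open>\<pi>\<close> itself serves as
  \<open>\<rho>\<close>. This is the substitute for weakening, and it is free.\<close>

lemma yields_subsumed:
  assumes "\<And>B. B \<in> \<B> \<Longrightarrow> subsumed \<A> B"
  shows "yields k F 0 \<A> \<B>"
  using assms unfolding yields_def subsumed_def by (metis add_0_right le_refl subset_refl subset_trans)

lemma yields_inferable:
  assumes "\<And>S. (\<forall>A \<in> \<A>. subsumed S A) \<Longrightarrow> subsumed S C \<or> (\<exists>D \<subseteq> C. inferable k F S D)"
  shows "yields k F 1 \<A> {C}"
  unfolding yields_def
proof (intro allI impI)
  fix \<pi> assume \<pi>: "derivation k F \<pi> \<and> (\<forall>A \<in> \<A>. subsumed (set \<pi>) A)"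
  show "\<exists>\<rho>. derivation k F \<rho> \<and> set \<pi> \<subseteq> set \<rho> \<and> length \<rho> \<le> length \<pi> + 1 \<and>
      (\<forall>B \<in> {C}. subsumed (set \<rho>) B)"
  proof (cases "subsumed (set \<pi>) C")
    case True
    then show ?thesis
      using \<pi> by (intro exI[of _ \<pi>]) auto
  next
    case False
    then obtain D where "D \<subseteq> C" "inferable k F (set \<pi>) D"
      using assms \<pi> by blast
    then show ?thesis
      using \<pi> derivation_snoc[of k F \<pi> D]
      by (intro exI[of _ "\<pi> @ [D]"]) (auto simp: subsumed_def)
  qed
qed

lemma yields_input:
  assumes "C \<in> F"
  shows "yields k F 1 \<A> {C}"
  using assms by (intro yields_inferable) (auto simp: inferable_def)

text \<open>If both subsuming clauses contain their pivot literal, their resolvent lies inside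
  \<open>E\<close>. Otherwise the one without its pivot already subsumes \<open>E\<close> and no
  line is added.\<close>

lemma yields_resolution:
  "yields k F 1 {insert (Pos x) E, insert (Neg x) E} {E}"
proof (rule yields_inferable)
  fix S assume "\<forall>A \<in> {insert (Pos x) E, insert (Neg x) E}. subsumed S A"
  then obtain C D where CD: "C \<in> S" "C \<subseteq> insert (Pos x) E" "D \<in> S" "D \<subseteq> insert (Neg x) E"
    unfolding subsumed_def by auto
  show "subsumed S E \<or> (\<exists>R \<subseteq> E. inferable k F S R)"
  proof (cases "Pos x \<in> C \<and> Neg x \<in> D")
    case True
    let ?R = "(C - {Pos x}) \<union> (D - {Neg x})"
    have "resolvent C D ?R"
      unfolding resolvent_def using True
      by (intro exI[of _ "C - {Pos x}"] exI[of _ "D - {Neg x}"] exI[of _ x]) auto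
    then have "inferable k F S ?R"
      using CD(1,3) unfolding inferable_def by blast
    moreover have "?R \<subseteq> E"
      using CD(2,4) by auto
    ultimately show ?thesis
      by blast
  next
    case False
    then have "C \<subseteq> E \<or> D \<subseteq> E"
      using CD(2,4) by (auto simp: subset_insert)
    then show ?thesis
      using CD(1,3) by (auto simp: subsumed_def)
  qed
qed

text \<open>Images preserve inclusion, so applying \<open>\<phi>\<close> to a clause that subsumes
  \<open>C\<close> gives one that subsumes the image of \<open>C\<close>.\<close>

lemma yields_symmetry:
  assumes "k_symmetry k \<phi>" "positive \<phi>" "(\<lambda>C. \<phi> ` C) ` F = F"
  shows "yields k F 1 {C} {\<phi> ` C}"
proof (rule yields_inferable)
  fix S assume "\<forall>A \<in> {C}. subsumed S A"
  then obtain D where "D \<in> S" "D \<subseteq> C"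
    unfolding subsumed_def by auto
  then have "inferable k F S (\<phi> ` D)" "\<phi> ` D \<subseteq> \<phi> ` C"
    using assms unfolding inferable_def by blast+
  then show "subsumed S (\<phi> ` C) \<or> (\<exists>D \<subseteq> \<phi> ` C. inferable k F S D)"
    by blast
qed

text \<open>Only the empty clause subsumes the empty clause; cutting the derivation right after an
  occurrence of it gives a proof.\<close>

lemma S_SR_I_le_if_yields:
  assumes "yields k F c {} {{}}"
  shows "S_SR_I k F \<le> enat c"
proof -
  have "derivation k F []"
    by (simp add: derivation_def)
  then obtain \<pi> where \<pi>: "derivation k F \<pi>" "length \<pi> \<le> c" "{} \<in> set \<pi>"
    using assms unfolding yields_def subsumed_def by force
  then obtain i where i: "i < length \<pi>" "\<pi> ! i = {}"
    by (auto simp: in_set_conv_nth)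
  have "SR_I_proof k F (take (Suc i) \<pi>)"
    using i
    by (intro SR_I_proof_if_derivation derivation_take[OF \<pi>(1)])
       (auto simp: take_Suc_conv_app_nth)
  then have "S_SR_I k F \<le> enat (length (take (Suc i) \<pi>))"
    unfolding S_SR_I_def by (intro INF_lower) auto
  also have "\<dots> \<le> enat c"
    using \<pi>(2) by simp
  finally show ?thesis .
qed

section \<open>Transpositions of pigeons\<close>

fun rename :: "('v \<Rightarrow> 'w) \<Rightarrow> 'v lit \<Rightarrow> 'w lit" where
  "rename f (Pos x) = Pos (f x)"
| "rename f (Neg x) = Neg (f x)"

text \<open>The restriction to \<open>j \<in> {1..m}\<close> keeps the set of moved variables finite, since every pair
  \<open>(i, j)\<close> is a variable.\<close>

definition swap_pigeons :: "nat \<Rightarrow> nat \<Rightarrow> nat \<Rightarrow> (nat \<times> nat) lit \<Rightarrow> (nat \<times> nat) lit" where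
  "swap_pigeons m s t = rename (\<lambda>(i, j). (if j \<in> {1..m} then transpose s t i else i, j))"

lemma swap_pigeons_swap_pigeons [simp]: "swap_pigeons m s t (swap_pigeons m s t l) = l"
  by (cases l) (auto simp: swap_pigeons_def)

lemma swap_pigeons_neq_clause:
  assumes "l \<le> m"
  shows "swap_pigeons m s t ` neq_clause l i y = neq_clause l (transpose s t i) y"
  unfolding neq_clause_def image_image using assms
  by (intro image_cong) (auto simp: swap_pigeons_def)

text \<open>Only the \<open>m\<close> bits of each of the two pigeons can move; this is the source
  of the bound \<open>2 * m\<close> on the symmetries.\<close>

lemma k_symmetry_swap_pigeons: "k_symmetry (2 * m) (swap_pigeons m s t)"
proof -
  let ?M = "{x. swap_pigeons m s t (Pos x) \<noteq> Pos x}"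
  have "bij (swap_pigeons m s t)"
    by (rule o_bij[of "swap_pigeons m s t"]) auto
  moreover have "swap_pigeons m s t (negl l) = negl (swap_pigeons m s t l)" for l
    by (cases l) (auto simp: swap_pigeons_def)
  moreover have sub: "?M \<subseteq> {s, t} \<times> {1..m}"
    by (auto simp: swap_pigeons_def transpose_def split: if_splits)
  moreover have "card ?M \<le> 2 * m"
  proof -
    have "card ?M \<le> card ({s, t} \<times> {1..m})"
      using sub by (intro card_mono) auto
    also have "\<dots> \<le> 2 * m"
      by (cases "s = t") (auto simp: card_cartesian_product)
    finally show ?thesis .
  qed
  ultimately show ?thesis
    unfolding k_symmetry_def using finite_subset[OF sub] by auto
qed

lemma positive_swap_pigeons: "positive (swap_pigeons m s t)"
  by (auto simp: positive_def swap_pigeons_def)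

lemma bPHP_memI:
  assumes "i \<in> {1..n + 1}" "j \<in> {1..n + 1}" "i \<noteq> j" "y < n"
  shows "neq_clause (floor_log n) i y \<union> neq_clause (floor_log n) j y \<in> bPHP n"
proof (cases "i < j")
  case True
  then show ?thesis
    using assms by (auto simp: bPHP_def)
next
  case False
  then have "neq_clause (floor_log n) j y \<union> neq_clause (floor_log n) i y \<in> bPHP n"
    using assms unfolding bPHP_def mem_Collect_eq by (intro exI[of _ j] exI[of _ i] exI[of _ y]) auto
  then show ?thesis
    by (simp add: Un_commute)
qed

lemma swap_pigeons_bPHP:
  assumes "s \<in> {1..n + 1}" "t \<in> {1..n + 1}"
  shows "(\<lambda>C. swap_pigeons (floor_log n) s t ` C) ` bPHP n = bPHP n"
proof -
  let ?\<phi> = "swap_pigeons (floor_log n) s t"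
  have sub: "?\<phi> ` C \<in> bPHP n" if C: "C \<in> bPHP n" for C
  proof -
    from C obtain i j y where C: "C = neq_clause (floor_log n) i y \<union> neq_clause (floor_log n) j y"
      and ij: "1 \<le> i" "i < j" "j \<le> n + 1" "y < n"
      unfolding bPHP_def by blast
    have "transpose s t i \<in> {1..n + 1}" "transpose s t j \<in> {1..n + 1}"
      using assms ij by (auto simp: transpose_def)
    moreover have "transpose s t i \<noteq> transpose s t j"
      using ij by (metis less_irrefl transpose_eq_iff)
    ultimately show ?thesis
      using ij by (simp add: C image_Un swap_pigeons_neq_clause bPHP_memI del: atLeastAtMost_iff)
  qed
  \<comment> \<open>\<open>?\<phi>\<close> is an involution, so mapping \<open>bPHP n\<close> into
    itself already makes it onto.\<close>
  show ?thesis
  proof (intro equalityI subsetI)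
    fix C assume "C \<in> bPHP n"
    then show "C \<in> (\<lambda>C. ?\<phi> ` C) ` bPHP n"
      using sub by (intro image_eqI[of _ _ "?\<phi> ` C"]) (auto simp: image_image)
  qed (use sub in auto)
qed

lemma yields_swap_pigeons:
  assumes "s \<in> {1..2 ^ m + 1}" "t \<in> {1..2 ^ m + 1}" "swap_pigeons m s t ` C \<subseteq> D"
  shows "yields (2 * m) (bPHP (2 ^ m)) 1 {C} {D}"
proof -
  have "yields (2 * m) (bPHP (2 ^ m)) 1 {C} {swap_pigeons m s t ` C}"
    using swap_pigeons_bPHP[OF assms(1,2)]
    by (intro yields_symmetry k_symmetry_swap_pigeons positive_swap_pigeons) simp
  moreover have "yields (2 * m) (bPHP (2 ^ m)) 0 ({C} \<union> {swap_pigeons m s t ` C}) {D}"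
    using assms(3) by (intro yields_subsumed) (auto simp: subsumed_def)
  ultimately have "yields (2 * m) (bPHP (2 ^ m)) (1 + 0) {C} ({swap_pigeons m s t ` C} \<union> {D})"
    by (rule yields_trans)
  then show ?thesis
    by (rule yields_mono) auto
qed

section \<open>Splitting a prefix\<close>

text \<open>With \<open>l\<close> at most the number of bits, \<open>neq_clause l i q\<close> says that the first \<open>l\<close> bits of
  pigeon \<open>i\<close> are not the prefix \<open>q\<close>.\<close>

lemma neq_clause_extend:
  "neq_clause (Suc l) i (2 * q) = insert (Pos (i, Suc l)) (neq_clause l i q)"
  "neq_clause (Suc l) i (2 * q + 1) = insert (Neg (i, Suc l)) (neq_clause l i q)"
proof -
  have *: "{1..Suc l} = insert (Suc l) {1..l}"
    by auto
  have b: "bit (2 * q) (Suc l - j) = bit q (l - j)" "bit (2 * q + 1) (Suc l - j) = bit q (l - j)"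
    if "j \<in> {1..l}" for j
    using that by (simp_all add: Suc_diff_le bit_Suc)
  show "neq_clause (Suc l) i (2 * q) = insert (Pos (i, Suc l)) (neq_clause l i q)"
    unfolding neq_clause_def * image_insert using b by (intro arg_cong2[of _ _ _ _ insert] image_cong) (auto simp: bit_0)
  show "neq_clause (Suc l) i (2 * q + 1) = insert (Neg (i, Suc l)) (neq_clause l i q)"
    unfolding neq_clause_def * image_insert using b by (intro arg_cong2[of _ _ _ _ insert] image_cong) (auto simp: bit_0)
qed

text \<open>For \<open>l\<close> at most the number of bits, this clause excludes that all pigeons
  of \<open>I\<close> share the \<open>l\<close>-bit prefix \<open>q\<close>.\<close>

definition crowd :: "nat \<Rightarrow> nat set \<Rightarrow> nat \<Rightarrow> (nat \<times> nat) clause" where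
  "crowd l I q = (\<Union>i \<in> I. neq_clause l i q)"

lemma swap_pigeons_crowd:
  assumes "l \<le> m"
  shows "swap_pigeons m s t ` crowd l I q = crowd l (transpose s t ` I) q"
  using assms by (simp add: crowd_def image_UN swap_pigeons_neq_clause)

text \<open>The normal form of a state: the first \<open>u\<close> pigeons went to
  \<open>q0\<close>, the next \<open>v\<close> to \<open>q1\<close>, and of the others up to
  \<open>N\<close> only the prefix \<open>q\<close> is known.\<close>

definition split_crowd :: "nat \<Rightarrow> nat \<Rightarrow> nat \<Rightarrow> nat \<Rightarrow> nat \<Rightarrow> (nat \<times> nat) clause" where
  "split_crowd N l q u v =
     crowd (Suc l) {1..u} (2 * q) \<union> crowd (Suc l) {u + 1..u + v} (2 * q + 1) \<union> crowd l {u + v + 1..N} q"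

lemma crowd_mono: "I \<subseteq> J \<Longrightarrow> crowd l I q \<subseteq> crowd l J q"
  unfolding crowd_def by blast

lemma crowd_insert: "crowd l (insert i I) q = neq_clause l i q \<union> crowd l I q"
  by (simp add: crowd_def)

text \<open>Resolve on the next bit of the first undecided pigeon \<open>w\<close>. Sent to
  \<open>q1\<close>, it extends the second block as it stands; sent to \<open>q0\<close>, it has to
  trade places with pigeon \<open>u + 1\<close>. Hence one symmetry line and one resolution
  line.\<close>

lemma yields_split_crowd:
  assumes "Suc l \<le> m" "u + v < N" "N \<le> 2 ^ m + 1"
  shows "yields (2 * m) (bPHP (2 ^ m)) 2 {split_crowd N l q (u + 1) v, split_crowd N l q u (v + 1)}
           {split_crowd N l q u v}"
proof -
  define w where "w = u + v + 1"
  let ?Y = "yields (2 * m) (bPHP (2 ^ m))"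
  let ?E = "split_crowd N l q u v"
  let ?P = "insert (Pos (w, Suc l)) ?E" and ?N = "insert (Neg (w, Suc l)) ?E"
  let ?C = "split_crowd N l q (u + 1) v" and ?D = "split_crowd N l q u (v + 1)"
  have rest: "{w..N} = insert w {w + 1..N}"
    using assms(2) by (auto simp: w_def)
  \<comment> \<open>The swap gives place \<open>u + 1\<close> of the first block to \<open>w\<close>
    and returns \<open>u + 1\<close> to the second block. For \<open>v = 0\<close> it is the
    identity, as then \<open>w = u + 1\<close>.\<close>
  have "{1..u + 1} = insert (u + 1) {1..u}"
    by auto
  then have "transpose (u + 1) w ` {1..u + 1} \<subseteq> insert w {1..u}"
    by (auto simp: w_def transpose_def)
  moreover have "transpose (u + 1) w ` {u + 2..w} \<subseteq> {u + 1..u + v}"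
    by (auto simp: w_def transpose_def)
  moreover have "transpose (u + 1) w ` {w + 1..N} \<subseteq> {w + 1..N}"
    by (auto simp: w_def transpose_def)
  ultimately have "crowd (Suc l) (transpose (u + 1) w ` {1..u + 1}) (2 * q) \<subseteq>
        neq_clause (Suc l) w (2 * q) \<union> crowd (Suc l) {1..u} (2 * q)"
      "crowd (Suc l) (transpose (u + 1) w ` {u + 2..w}) (2 * q + 1) \<subseteq>
        crowd (Suc l) {u + 1..u + v} (2 * q + 1)"
      "crowd l (transpose (u + 1) w ` {w + 1..N}) q \<subseteq> crowd l {w + 1..N} q"
    by (simp_all only: crowd_mono flip: crowd_insert)
  moreover have C: "?C = crowd (Suc l) {1..u + 1} (2 * q) \<union> crowd (Suc l) {u + 2..w} (2 * q + 1) \<union>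
      crowd l {w + 1..N} q"
    by (simp add: split_crowd_def w_def)
  moreover have E: "?E = crowd (Suc l) {1..u} (2 * q) \<union> crowd (Suc l) {u + 1..u + v} (2 * q + 1) \<union>
      (neq_clause l w q \<union> crowd l {w + 1..N} q)"
    unfolding crowd_insert[symmetric] rest[symmetric] by (simp add: split_crowd_def w_def)
  ultimately have "swap_pigeons m (u + 1) w ` ?C \<subseteq> ?P"
    using assms(1) unfolding C image_Un neq_clause_extend(1)
    by (simp only: swap_pigeons_crowd Suc_leD) blast
  then have 1: "?Y 1 {?C} {?P}"
    by (rule yields_swap_pigeons[rotated 2]) (use assms in \<open>auto simp: w_def\<close>)
  have "{u + 1..w} = insert w {u + 1..u + v}"
    by (auto simp: w_def)
  then have "crowd (Suc l) {u + 1..w} (2 * q + 1) =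
      neq_clause (Suc l) w (2 * q + 1) \<union> crowd (Suc l) {u + 1..u + v} (2 * q + 1)"
    by (simp only: crowd_insert)
  moreover have "?D = crowd (Suc l) {1..u} (2 * q) \<union> crowd (Suc l) {u + 1..w} (2 * q + 1) \<union>
      crowd l {w + 1..N} q"
    by (simp add: split_crowd_def w_def)
  ultimately have D: "?D \<subseteq> ?N"
    unfolding E neq_clause_extend(2) by blast
  have 2: "?Y 0 {?D} {?N}"
    using D by (intro yields_subsumed) (auto simp: subsumed_def)
  have "?Y (1 + 0) {?C, ?D} ({?P} \<union> {?N})"
    by (rule yields_trans[OF yields_mono[OF 1] yields_mono[OF 2]]) auto
  moreover have "?Y 1 ({?C, ?D} \<union> ({?P} \<union> {?N})) {?E}"
    by (rule yields_mono[OF yields_resolution]) auto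
  ultimately have "?Y (1 + 0 + 1) {?C, ?D} (({?P} \<union> {?N}) \<union> {?E})"
    by (rule yields_trans)
  then show ?thesis
    by (rule yields_mono) auto
qed

section \<open>Filling the grid of states and merging two subprefixes\<close>

text \<open>The grid of pairs \<open>(u, v)\<close> is filled backwards from the borders
  \<open>u = a + 1\<close> and \<open>v = a + 1\<close>, one column per value of \<open>u\<close>.
  Inside it \<open>u + v \<le> 2 * a\<close>, so an undecided pigeon is left. A column has
  \<open>a + 1\<close> new states at two lines each.\<close>

lemma yields_columns:
  assumes "Suc l \<le> m" "2 * a + 1 \<le> 2 ^ m + 1" "d \<le> a + 1"
  shows "yields (2 * m) (bPHP (2 ^ m)) (d * (2 * (a + 1)))
           (range (split_crowd (2 * a + 1) l q (a + 1)) \<union>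
            (\<lambda>u. split_crowd (2 * a + 1) l q u (a + 1)) ` {..a})
           (split_crowd (2 * a + 1) l q (a + 1 - d) ` {..a + 1})"
  using assms(3)
proof (induction d)
  case 0
  then show ?case
    by (simp, intro yields_subsumed) (auto simp: subsumed_def)
next
  case (Suc d)
  let ?Y = "yields (2 * m) (bPHP (2 ^ m))"
  let ?U = "split_crowd (2 * a + 1) l q"
  let ?B = "range (?U (a + 1)) \<union> (\<lambda>u. ?U u (a + 1)) ` {..a}"
  define u where "u = a - d"
  have u: "u \<le> a" "a + 1 - d = u + 1" "a + 1 - Suc d = u"
    using Suc.prems by (auto simp: u_def)
  \<comment> \<open>Column \<open>u\<close> is filled downwards from its border state
    \<open>v = a + 1\<close>; each state uses its neighbours at \<open>(u + 1, v)\<close> and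
    \<open>(u, v + 1)\<close>.\<close>
  have "?Y (e * 2) (?B \<union> ?U (u + 1) ` {..a + 1}) (?U u ` {a + 1 - e..a + 1})" if "e \<le> a + 1" for e
    using that
  proof (induction e)
    case 0
    then show ?case
      using u(1) by (simp, intro yields_subsumed) (auto simp: subsumed_def)
  next
    case (Suc e)
    define v where "v = a - e"
    have v: "v \<le> a" "a + 1 - e = v + 1" "a + 1 - Suc e = v"
      using Suc.prems by (auto simp: v_def)
    have "?Y 2 {?U (u + 1) v, ?U u (v + 1)} {?U u v}"
      using assms u v by (intro yields_split_crowd) auto
    then have "?Y 2 ((?B \<union> ?U (u + 1) ` {..a + 1}) \<union> ?U u ` {a + 1 - e..a + 1}) {?U u v}"
      by (rule yields_mono) (use v in auto)
    then have "?Y (e * 2 + 2) (?B \<union> ?U (u + 1) ` {..a + 1}) (?U u ` {a + 1 - e..a + 1} \<union> {?U u v})"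
      using Suc by (intro yields_trans) auto
    moreover have "{v..a + 1} = insert v {v + 1..a + 1}"
      using v by auto
    ultimately show ?case
      unfolding v by (elim yields_mono) auto
  qed
  from this[of "a + 1"]
  have "?Y ((a + 1) * 2) (?B \<union> ?U (u + 1) ` {..a + 1}) (?U u ` {..a + 1})"
    by (simp add: atLeast0AtMost)
  then have "?Y (d * (2 * (a + 1)) + (a + 1) * 2) ?B (?U (u + 1) ` {..a + 1} \<union> ?U u ` {..a + 1})"
    using Suc u by (intro yields_trans) auto
  then show ?case
    unfolding u by (rule yields_mono) auto
qed

text \<open>A window of \<open>a + 1\<close> pigeons slides by one when its first pigeon is
  exchanged for the one just after it. Sliding one place at a time keeps each move a single
  transposition and produces all windows in \<open>d\<close> lines.\<close>

lemma yields_shift_crowd: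
  assumes "l \<le> m" "2 * a + 1 \<le> 2 ^ m + 1" "d \<le> a"
  shows "yields (2 * m) (bPHP (2 ^ m)) d {crowd l {1..a + 1} q}
           ((\<lambda>u. crowd l {u + 1..u + a + 1} q) ` {..d})"
  using assms(3)
proof (induction d)
  case 0
  then show ?case
    by (intro yields_subsumed) (auto simp: subsumed_def)
next
  case (Suc d)
  let ?Y = "yields (2 * m) (bPHP (2 ^ m))"
  let ?V = "\<lambda>u. crowd l {u + 1..u + a + 1} q"
  have "transpose (d + 1) (d + a + 2) ` {d + 1..d + a + 1} \<subseteq> {Suc d + 1..Suc d + a + 1}"
    by (auto simp: transpose_def)
  then have "?Y 1 {?V d} {?V (Suc d)}"
    using assms Suc.prems
    by (intro yields_swap_pigeons[of "d + 1" _ "d + a + 2"])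
       (auto simp only: swap_pigeons_crowd crowd_mono, auto)
  then have "?Y 1 ({crowd l {1..a + 1} q} \<union> ?V ` {..d}) {?V (Suc d)}"
    by (rule yields_mono) auto
  then have "?Y (d + 1) {crowd l {1..a + 1} q} (?V ` {..d} \<union> {?V (Suc d)})"
    using Suc by (intro yields_trans) auto
  then show ?case
    by (rule yields_mono) (auto simp: atMost_Suc)
qed

text \<open>The borders of the grid come from the two premises: at \<open>u = a + 1\<close> the
  state contains the first premise, at \<open>v = a + 1\<close> a shifted copy of the second. The
  corner \<open>(0, 0)\<close> is the goal, since no pigeon has been sent anywhere.\<close>

lemma yields_merge:
  assumes "Suc l \<le> m" "2 * a \<le> 2 ^ m" "1 \<le> a"
  shows "yields (2 * m) (bPHP (2 ^ m)) (9 * a\<^sup>2)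
           {crowd (Suc l) {1..a + 1} (2 * q), crowd (Suc l) {1..a + 1} (2 * q + 1)}
           {crowd l {1..2 * a + 1} q}"
proof -
  let ?Y = "yields (2 * m) (bPHP (2 ^ m))"
  let ?T0 = "crowd (Suc l) {1..a + 1} (2 * q)" and ?T1 = "crowd (Suc l) {1..a + 1} (2 * q + 1)"
  let ?V = "\<lambda>u. crowd (Suc l) {u + 1..u + a + 1} (2 * q + 1)"
  let ?U = "split_crowd (2 * a + 1) l q"
  let ?B = "range (?U (a + 1)) \<union> (\<lambda>u. ?U u (a + 1)) ` {..a}"
  have "?Y a {?T0, ?T1} (?V ` {..a})"
    by (rule yields_mono[OF yields_shift_crowd[of "Suc l" m a a "2 * q + 1"]]) (use assms in auto)
  moreover have "?Y 0 ({?T0, ?T1} \<union> ?V ` {..a}) ?B"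
  proof (rule yields_subsumed)
    fix C assume "C \<in> ?B"
    then consider v where "C = ?U (a + 1) v" | u where "u \<le> a" "C = ?U u (a + 1)"
      by auto
    then show "subsumed ({?T0, ?T1} \<union> ?V ` {..a}) C"
    proof cases
      case 1
      then have "?T0 \<subseteq> C"
        unfolding split_crowd_def by blast
      then show ?thesis
        unfolding subsumed_def by blast
    next
      case 2
      then have "?V u \<subseteq> C"
        unfolding split_crowd_def by (simp only: add.assoc) blast
      then show ?thesis
        using \<open>u \<le> a\<close> unfolding subsumed_def by blast
    qed
  qed
  ultimately have "?Y (a + 0) {?T0, ?T1} (?V ` {..a} \<union> ?B)"
    by (rule yields_trans)
  moreover have "?Y ((a + 1) * (2 * (a + 1))) ({?T0, ?T1} \<union> (?V ` {..a} \<union> ?B)) (?U 0 ` {..a + 1})"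
    using yields_columns[of l m a "a + 1" q] assms by (auto elim!: yields_mono)
  ultimately have "?Y (a + 0 + (a + 1) * (2 * (a + 1))) {?T0, ?T1} ((?V ` {..a} \<union> ?B) \<union> ?U 0 ` {..a + 1})"
    by (rule yields_trans)
  moreover have "?U 0 0 = crowd l {1..2 * a + 1} q"
    by (simp add: split_crowd_def crowd_def)
  moreover have "a + 0 + (a + 1) * (2 * (a + 1)) \<le> 9 * a\<^sup>2"
  proof -
    \<comment> \<open>The constant 9 is the sum 2 + 5 + 2 of the coefficients, attained at
      \<open>a = 1\<close>.\<close>
    have "a + 0 + (a + 1) * (2 * (a + 1)) = 2 * a\<^sup>2 + 5 * a + 2"
      by (simp add: power2_eq_square algebra_simps)
    moreover have "a \<le> a\<^sup>2" "1 \<le> a\<^sup>2"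
      using assms(3) by (simp_all add: power2_eq_square)
    ultimately show ?thesis
      by linarith
  qed
  ultimately show ?thesis
    by (elim yields_mono) (auto simp: image_iff intro!: bexI[of _ 0] dest: sym)
qed

section \<open>Recursion over the tree of prefixes and the final bound\<close>

text \<open>Two subprefixes at \<open>5 * 4 ^ h\<close> each and a merge at \<open>9 * 4 ^ h\<close>
  make \<open>19 * 4 ^ h\<close>, below \<open>5 * 4 ^ Suc h\<close>; 5 is the least integer
  \<open>c\<close> with \<open>2 * c + 9 \<le> 4 * c\<close>.\<close>

lemma yields_crowd:
  assumes "h \<le> m" "q < 2 ^ (m - h)"
  shows "yields (2 * m) (bPHP (2 ^ m)) (5 * 4 ^ h) {} {crowd (m - h) {1..2 ^ h + 1} q}"
  using assms
proof (induction h arbitrary: q)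
  case 0
  have "neq_clause (floor_log (2 ^ m)) 1 q \<union> neq_clause (floor_log (2 ^ m)) 2 q \<in> bPHP (2 ^ m)"
    using 0 by (intro bPHP_memI) auto
  moreover have "{1..2 ^ 0 + 1} = {1, 2 :: nat}"
    by auto
  ultimately have "crowd (m - 0) {1..2 ^ 0 + 1} q \<in> bPHP (2 ^ m)"
    by (simp add: crowd_def)
  then show ?case
    by (intro yields_mono[OF yields_input]) auto
next
  case (Suc h)
  let ?Y = "yields (2 * m) (bPHP (2 ^ m))"
  let ?T = "\<lambda>q. crowd (m - h) {1..2 ^ h + 1} q"
  define l where "l = m - Suc h"
  have l: "m - h = Suc l"
    using Suc.prems by (simp add: l_def)
  have q: "2 * q < 2 ^ (m - h)" "2 * q + 1 < 2 ^ (m - h)"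
    using Suc.prems unfolding l l_def[symmetric] by auto
  have "?Y (5 * 4 ^ h) {} {?T (2 * q)}" "?Y (5 * 4 ^ h) ({} \<union> {?T (2 * q)}) {?T (2 * q + 1)}"
    using Suc q by (auto intro: yields_mono[OF Suc.IH])
  then have "?Y (5 * 4 ^ h + 5 * 4 ^ h) {} ({?T (2 * q)} \<union> {?T (2 * q + 1)})"
    by (rule yields_trans)
  moreover have "?Y (9 * (2 ^ h)\<^sup>2) ({} \<union> ({?T (2 * q)} \<union> {?T (2 * q + 1)}))
      {crowd l {1..2 * 2 ^ h + 1} q}"
    unfolding l
  proof (rule yields_mono[OF yields_merge])
    show "2 * 2 ^ h \<le> (2 :: nat) ^ m"
      using Suc.prems by (metis power_Suc power_increasing one_le_numeral)
  qed (use Suc.prems in \<open>auto simp: l_def\<close>)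
  ultimately have "?Y (5 * 4 ^ h + 5 * 4 ^ h + 9 * (2 ^ h)\<^sup>2) {}
      (({?T (2 * q)} \<union> {?T (2 * q + 1)}) \<union> {crowd l {1..2 * 2 ^ h + 1} q})"
    by (rule yields_trans)
  moreover have "((2::nat) ^ h)\<^sup>2 = 4 ^ h"
    by (simp add: power2_eq_square flip: power_mult_distrib)
  ultimately show ?case
    by (elim yields_mono) (auto simp: l_def)
qed

lemma S_SR_I_bPHP_le: "S_SR_I (2 * m) (bPHP (2 ^ m)) \<le> enat (5 * (2 ^ m)\<^sup>2)"
proof (rule S_SR_I_le_if_yields)
  \<comment> \<open>With all \<open>m\<close> bits free the prefix is empty, so no literal
    remains.\<close>
  have "crowd 0 {1..2 ^ m + 1} 0 = {}"
    by (simp add: crowd_def neq_clause_def)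
  moreover have "((2::nat) ^ m)\<^sup>2 = 4 ^ m"
    by (simp add: power2_eq_square flip: power_mult_distrib)
  ultimately show "yields (2 * m) (bPHP (2 ^ m)) (5 * (2 ^ m)\<^sup>2) {} {{}}"
    using yields_crowd[of m m 0] by simp
qed

text \<open>\<open>the_enat\<close> is informative only at finite values, hence the separate
  finiteness claim. The filter lets \<open>n\<close> grow along the powers of 2.\<close>

theorem theorem15:
  shows "(\<forall>n \<in> range (\<lambda>m. 2 ^ m). S_SR_I (2 * floor_log n) (bPHP n) \<noteq> \<infinity>) \<and>
    (\<lambda>n. real (the_enat (S_SR_I (2 * floor_log n) (bPHP n))))
      \<in> O[inf at_top (principal (range (\<lambda>m. 2 ^ m)))](\<lambda>n. real n ^ 2)"
proof -
  have le: "S_SR_I (2 * floor_log n) (bPHP n) \<le> enat (5 * n\<^sup>2)" if "n \<in> range (\<lambda>m. 2 ^ m)" for n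
    using that S_SR_I_bPHP_le by auto
  have real_le: "real (the_enat (S_SR_I (2 * floor_log n) (bPHP n))) \<le> 5 * real n ^ 2"
    if n: "n \<in> range (\<lambda>m. 2 ^ m)" for n
  proof -
    have "the_enat (S_SR_I (2 * floor_log n) (bPHP n)) \<le> 5 * n\<^sup>2"
      using le[OF n] by (cases "S_SR_I (2 * floor_log n) (bPHP n)") auto
    then have "real (the_enat (S_SR_I (2 * floor_log n) (bPHP n))) \<le> real (5 * n\<^sup>2)"
      by (rule of_nat_mono)
    then show ?thesis
      by simp
  qed
  show ?thesis
  proof
    show "\<forall>n \<in> range (\<lambda>m. 2 ^ m). S_SR_I (2 * floor_log n) (bPHP n) \<noteq> \<infinity>"
      using le by (metis enat_ord_simps(5) infinity_ne_i1 enat.distinct(1))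
    show "(\<lambda>n. real (the_enat (S_SR_I (2 * floor_log n) (bPHP n))))
        \<in> O[inf at_top (principal (range (\<lambda>m. 2 ^ m)))](\<lambda>n. real n ^ 2)"
      using real_le by (intro bigoI[of _ 5]) (auto simp: eventually_inf_principal)
  qed
qed

end
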